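(* Let $\hat g(\bm i)=\sum_{j=1}^J\lambda_jb_jP(D_j(\tau)\ge i_j)$ for $\bm i\in\mathcal S$. Assume $\hat g(\bm i^0)\le\alpha^*$ and that $\hat g(\bm i)>\alpha^*$ for at least one state $\bm i\in\mathcal S$. Then the policy $$\mu_{\alpha^*}(\bm i)=\begin{cases}\text{continue}&\text{if }\hat g(\bm i)\le\alpha^*,\\ \text{stop}&\text{if }\hat g(\bm i)>\alpha^*,\end{cases}$$ i.e. the policy with trigger set $\{\bm i\in\mathcal S:\hat g(\bm i)>\alpha^*\}$, is optimal, and its long-run average cost per unit time is $c(\mu_{\alpha^*})=\alpha^*$.
   Context: Setting. There are $J\ge 1$ items. For each item $j$ let $Q_j\ge 1$ be an integer (slot capacity), $\lambda_j>0$ the demand rate and $b_j>0$ the unit stockout cost. $A>0$ is the fixed replenishment cost and $\tau>0$ the lead time. Put $\Lambda=\sum_{j=1}^J\lambda_j$ and $p_j=\lambda_j/\Lambda$. $D_j(\tau)$ is a Poisson random variable with mean $\lambda_j\tau$ (so $P(D_j(\tau)=r)=0$ for $r<0$). The state space is $\mathcal S=\{\bm i=(i_1,\dots,i_J)\in\mathbb Z^J: i_j\le Q_j\ \forall j\}$; the initial state is $\bm i^0=\bm Q=(Q_1,\dots,Q_J)$; $\bm i^{-j}$ denotes $\bm i$ with its $j$-th coordinate decreased by $1$. The expected cost of triggering a replenishment in state $\bm i$ is $$G(\bm i)=A+\sum_{j=1}^J b_j\sum_{r=i_j}^\infty (r-i_j)P(D_j(\tau)=r).$$ Dynamics. Starting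 from $\bm i^0$, the chain $\bm i^0,\bm i^1,\bm i^2,\dots$ moves at each step from $\bm i$ to $\bm i^{-j}$ with probability $p_j$; each step takes mean time $1/\Lambda$. A trigger set is a subset $\mathcal U\subset\mathcal S$. When the chain first enters $\mathcal U$, at step $N_{\mathcal U}$, a replenishment is triggered ("stop"), which takes time $\tau$, costs $G(\bm i^{N_{\mathcal U}})$ (the only cost in the cycle) and returns the system to $\bm i^0$. $\mathcal U$ is admissible if $\bm i^0\notin\mathcal U$ and $E[N_{\mathcal U}]<\infty$. The long-run average cost per unit time of (the policy with) an admissible trigger set $\mathcal U$ is $$\alpha_{\mathcal U}=\frac{E[G(\bm i^{N_{\mathcal U}})]}{\tau+E[N_{\mathcal U}]/\Lambda},$$ and $\alpha^*=\min\{\alpha_{\mathcal U}:\mathcal U\text{ admissible}\}$ (the minimum is taken to be attained). A policy is optimal if its trigger set attains $\alpha^*$. For a policy $\mu$, $c(\mu)$ denotes its long-run average cost per unit time. *)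

theory Defs
  imports "HOL-Probability.Probability"
begin

text \<open>
  Items are the elements of a finite (hence nonempty) type. A state assigns to every item
  an integer stock level, where negative values are allowed.
\<close>

type_synonym 'j state = "'j \<Rightarrow> int"

definition state_space :: "'j state \<Rightarrow> 'j state set" where
  "state_space Q = {i. \<forall>j. i j \<le> Q j}"

definition lead_demand :: "real \<Rightarrow> real \<Rightarrow> int pmf" where
  "lead_demand lam \<tau> = map_pmf int (poisson_pmf (lam * \<tau>))"

definition trigger_cost ::
    "('j::finite \<Rightarrow> real) \<Rightarrow> ('j \<Rightarrow> real) \<Rightarrow> real \<Rightarrow> real \<Rightarrow> 'j state \<Rightarrow> real" where
  "trigger_cost lam b A \<tau> i =
     A + (\<Sum>j\<in>UNIV. b j *
            (\<Sum>\<^sub>\<infinity>r\<in>{i j..}. real_of_int (r - i j) * pmf (lead_demand (lam j) \<tau>) r))"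

definition total_rate :: "('j::finite \<Rightarrow> real) \<Rightarrow> real" where
  "total_rate lam = (\<Sum>j\<in>UNIV. lam j)"

text \<open>A genuine distribution with the given weights only for positive rates, see below.\<close>

definition item_pmf :: "('j::finite \<Rightarrow> real) \<Rightarrow> 'j pmf" where
  "item_pmf lam = embed_pmf (\<lambda>j. lam j / total_rate lam)"

lemma pmf_item_pmf:
  fixes lam :: "'j::finite \<Rightarrow> real"
  assumes pos: "\<And>j. lam j > 0"
  shows "pmf (item_pmf lam) j = lam j / total_rate lam"
proof -
  have L: "total_rate lam > 0"
    unfolding total_rate_def by (rule sum_pos) (auto simp: pos)
  have nonneg: "0 \<le> lam k / total_rate lam" for k
    using pos[of k] L by simp
  have "(\<integral>\<^sup>+k. ennreal (lam k / total_rate lam) \<partial>count_space UNIV) =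
          ennreal (\<Sum>k\<in>UNIV. lam k / total_rate lam)"
    by (simp add: nn_integral_count_space_finite nonneg)
  also have "(\<Sum>k\<in>UNIV. lam k / total_rate lam) = 1"
    using L by (simp add: sum_divide_distrib[symmetric] total_rate_def)
  finally show ?thesis
    unfolding item_pmf_def using nonneg by (subst pmf_embed_pmf) auto
qed

text \<open>
  The chain is driven by the independent, identically distributed sequence of demanded items:
  the demand \<open>w n\<close> lowers the level of that item by one in step \<open>n\<close>.
\<close>

definition demand_space :: "('j::finite \<Rightarrow> real) \<Rightarrow> (nat \<Rightarrow> 'j) measure" where
  "demand_space lam = (\<Pi>\<^sub>M n\<in>UNIV. measure_pmf (item_pmf lam))"

definition decrease :: "'j \<Rightarrow> 'j state \<Rightarrow> 'j state" where
  "decrease j i = i(j := i j - 1)"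

primrec chain :: "'j state \<Rightarrow> (nat \<Rightarrow> 'j) \<Rightarrow> nat \<Rightarrow> 'j state" where
  "chain Q w 0 = Q"
| "chain Q w (Suc n) = decrease (w n) (chain Q w n)"

text \<open>The hitting time is \<open>\<infinity>\<close> if the trigger set is never entered.\<close>

definition hit_time :: "'j state \<Rightarrow> 'j state set \<Rightarrow> (nat \<Rightarrow> 'j) \<Rightarrow> enat" where
  "hit_time Q U w = (INF n\<in>{n. chain Q w n \<in> U}. enat n)"

definition expected_steps ::
    "'j state \<Rightarrow> ('j::finite \<Rightarrow> real) \<Rightarrow> 'j state set \<Rightarrow> ennreal" where
  "expected_steps Q lam U = (\<integral>\<^sup>+w. ennreal_of_enat (hit_time Q U w) \<partial>demand_space lam)"

definition admissible :: "'j state \<Rightarrow> ('j::finite \<Rightarrow> real) \<Rightarrow> 'j state set \<Rightarrow> bool" where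
  "admissible Q lam U \<longleftrightarrow> U \<subseteq> state_space Q \<and> Q \<notin> U \<and> expected_steps Q lam U < \<infinity>"

text \<open>
  Used for admissible trigger sets only. There the hitting time is almost surely finite, and the
  cost at that time is integrable because \<open>trigger_cost\<close> grows at most linearly along the chain.
\<close>

definition avg_cost ::
    "'j state \<Rightarrow> ('j::finite \<Rightarrow> real) \<Rightarrow> ('j \<Rightarrow> real) \<Rightarrow> real \<Rightarrow> real \<Rightarrow> 'j state set \<Rightarrow> real" where
  "avg_cost Q lam b A \<tau> U =
     (\<integral>w. trigger_cost lam b A \<tau> (chain Q w (the_enat (hit_time Q U w))) \<partial>demand_space lam)
     / (\<tau> + enn2real (expected_steps Q lam U) / total_rate lam)"

definition opt_cost ::
    "'j state \<Rightarrow> ('j::finite \<Rightarrow> real) \<Rightarrow> ('j \<Rightarrow> real) \<Rightarrow> real \<Rightarrow> real \<Rightarrow> real" where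
  "opt_cost Q lam b A \<tau> = (INF U\<in>{U. admissible Q lam U}. avg_cost Q lam b A \<tau> U)"

datatype action = Continue | Stop

type_synonym 'j policy = "'j state \<Rightarrow> action"

definition trigger_set :: "'j state \<Rightarrow> 'j policy \<Rightarrow> 'j state set" where
  "trigger_set Q \<mu> = {i \<in> state_space Q. \<mu> i = Stop}"

definition policy_cost ::
    "'j state \<Rightarrow> ('j::finite \<Rightarrow> real) \<Rightarrow> ('j \<Rightarrow> real) \<Rightarrow> real \<Rightarrow> real \<Rightarrow> 'j policy \<Rightarrow> real" where
  "policy_cost Q lam b A \<tau> \<mu> = avg_cost Q lam b A \<tau> (trigger_set Q \<mu>)"

definition optimal_policy ::
    "'j state \<Rightarrow> ('j::finite \<Rightarrow> real) \<Rightarrow> ('j \<Rightarrow> real) \<Rightarrow> real \<Rightarrow> real \<Rightarrow> 'j policy \<Rightarrow> bool" where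
  "optimal_policy Q lam b A \<tau> \<mu> \<longleftrightarrow>
     admissible Q lam (trigger_set Q \<mu>) \<and>
     avg_cost Q lam b A \<tau> (trigger_set Q \<mu>) = opt_cost Q lam b A \<tau>"

definition g_hat ::
    "('j::finite \<Rightarrow> real) \<Rightarrow> ('j \<Rightarrow> real) \<Rightarrow> real \<Rightarrow> 'j state \<Rightarrow> real" where
  "g_hat lam b \<tau> i =
     (\<Sum>j\<in>UNIV. lam j * b j * measure_pmf.prob (lead_demand (lam j) \<tau>) {i j..})"

definition threshold_policy ::
    "('j::finite \<Rightarrow> real) \<Rightarrow> ('j \<Rightarrow> real) \<Rightarrow> real \<Rightarrow> real \<Rightarrow> 'j policy" where
  "threshold_policy lam b \<tau> \<alpha> i = (if g_hat lam b \<tau> i \<le> \<alpha> then Continue else Stop)"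

end

theory Submission
  imports Defs
begin

text \<open>
  One demand for item \<open>j\<close> raises the trigger cost by \<open>b j * P(D j \<ge> i j)\<close>, so its expected
  one-step increment is \<open>g_hat / total_rate\<close>. Hence stopping at the entry into \<open>U\<close> costs the
  initial trigger cost plus the expected sum of these increments before stopping, and comparing the
  cost of \<open>U\<close> with \<open>\<alpha>\<close> amounts to summing \<open>g_hat - \<alpha>\<close> up to the stopping time. Since \<open>g_hat\<close>
  never decreases along the chain, stopping when it first exceeds \<open>\<alpha>\<close> minimises that sum on
  every path. All expectations are kept in \<open>ennreal\<close>, where monotone convergence applies because the
  trigger cost also never decreases along the chain.
\<close>

section \<open>One-step increments of the trigger cost\<close>

text \<open>The extra index \<open>i - 1\<close> carries weight zero, and on the common range the
  weights differ by exactly one.\<close>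

lemma sum_int_atLeast_shift:
  fixes f :: "int \<Rightarrow> real"
  assumes "f summable_on {i..}" and "(\<lambda>r. real_of_int (r - i) * f r) summable_on {i..}"
  shows "(\<Sum>\<^sub>\<infinity>r\<in>{i - 1..}. real_of_int (r - (i - 1)) * f r) =
    (\<Sum>\<^sub>\<infinity>r\<in>{i..}. real_of_int (r - i) * f r) + (\<Sum>\<^sub>\<infinity>r\<in>{i..}. f r)"
proof -
  have "(\<Sum>\<^sub>\<infinity>r\<in>{i - 1..}. real_of_int (r - (i - 1)) * f r) =
      (\<Sum>\<^sub>\<infinity>r\<in>{i..}. real_of_int (r - i) * f r + f r)"
  proof (rule infsum_cong_neutral)
    fix r assume "r \<in> {i - 1..} - {i..}"
    then have "r = i - 1" by auto
    then show "real_of_int (r - (i - 1)) * f r = 0" by simp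
  qed (auto simp: algebra_simps)
  also have "\<dots> = (\<Sum>\<^sub>\<infinity>r\<in>{i..}. real_of_int (r - i) * f r) + (\<Sum>\<^sub>\<infinity>r\<in>{i..}. f r)"
    by (rule infsum_add[OF assms(2) assms(1)])
  finally show ?thesis .
qed

lemma pmf_summable_on: "pmf p summable_on A"
proof -
  have "Infinite_Sum.abs_summable_on (pmf p) A"
    by (simp only: abs_summable_equivalent pmf_abs_summable)
  then show ?thesis by (rule abs_summable_summable)
qed

lemma infsum_pmf: "(\<Sum>\<^sub>\<infinity>r\<in>A. pmf p r) = measure_pmf.prob p A"
  by (simp add: measure_pmf_conv_infsetsum infsetsum_infsum pmf_abs_summable)

text \<open>Shifting the index cancels the factor \<open>n\<close> against the factorial, which
  leaves a multiple of the exponential series.\<close>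

lemma poisson_first_moment_summable:
  assumes "m > 0"
  shows "(\<lambda>n. real n * pmf (poisson_pmf m) n) summable_on UNIV"
proof -
  have "summable (\<lambda>n. real n * pmf (poisson_pmf m) n)"
  proof (subst summable_Suc_iff[symmetric])
    have "(\<lambda>n. real (Suc n) * pmf (poisson_pmf m) (Suc n)) = (\<lambda>n. m * exp (- m) * (m ^ n / fact n))"
      using assms by (simp add: fun_eq_iff del: of_nat_Suc)
    moreover have "summable (\<lambda>n. m * exp (- m) * (m ^ n / fact n))"
      using summable_exp[of m] by (intro summable_mult) (simp add: field_simps)
    ultimately show "summable (\<lambda>n. real (Suc n) * pmf (poisson_pmf m) (Suc n))" by simp
  qed
  then show ?thesis by (subst summable_on_UNIV_nonneg_real_iff) auto
qed

lemma lead_demand_first_moment_summable: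
  assumes "lam * \<tau> > 0"
  shows "(\<lambda>r. real_of_int r * pmf (lead_demand lam \<tau>) r) summable_on A"
proof -
  have "(\<lambda>r. real_of_int r * pmf (lead_demand lam \<tau>) r) summable_on range int"
    by (subst summable_on_reindex)
      (use poisson_first_moment_summable[OF assms] in
        \<open>simp_all add: o_def lead_demand_def pmf_map_inj'\<close>)
  then have "(\<lambda>r. real_of_int r * pmf (lead_demand lam \<tau>) r) summable_on UNIV"
    \<comment> \<open>Negative integers carry no mass, so only \<open>range int\<close>
      contributes.\<close>
    by (rule summable_on_cong_neutral[THEN iffD1, rotated -1])
      (auto simp: lead_demand_def pmf_eq_0_set_pmf)
  then show ?thesis using summable_on_subset_banach by blast
qed

text \<open>Only the summand of item \<open>j\<close> changes. Lowering its level by one adds the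
  mass of the tail from \<open>i j\<close> on, by \<open>sum_int_atLeast_shift\<close>.\<close>

lemma trigger_cost_decrease:
  assumes "\<And>j. lam j > 0" and "\<tau> > 0"
  shows "trigger_cost lam b A \<tau> (decrease j i) =
    trigger_cost lam b A \<tau> i + b j * measure_pmf.prob (lead_demand (lam j) \<tau>) {i j..}"
proof -
  define h where "h k x = b k * (\<Sum>\<^sub>\<infinity>r\<in>{x..}. real_of_int (r - x) * pmf (lead_demand (lam k) \<tau>) r)"
    for k and x :: int
  \<comment> \<open>This is the function \<open>(r - i j) * pmf r\<close> multiplied out, whose
    summability the shift lemma requires.\<close>
  have "(\<lambda>r. real_of_int r * pmf (lead_demand (lam j) \<tau>) r
      + (- real_of_int (i j)) * pmf (lead_demand (lam j) \<tau>) r) summable_on {i j..}"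
    using assms by (intro summable_on_add lead_demand_first_moment_summable
        summable_on_cmult_right pmf_summable_on) auto
  then have "h j (i j - 1) = h j (i j) + b j * measure_pmf.prob (lead_demand (lam j) \<tau>) {i j..}"
    unfolding h_def
    by (subst sum_int_atLeast_shift)
      (auto simp: pmf_summable_on infsum_pmf algebra_simps)
  moreover have "(\<Sum>k\<in>UNIV. h k (x k)) = h j (x j) + (\<Sum>k\<in>UNIV - {j}. h k (x k))" for x
    by (rule sum.remove) auto
  moreover have "(\<Sum>k\<in>UNIV - {j}. h k (decrease j i k)) = (\<Sum>k\<in>UNIV - {j}. h k (i k))"
    by (rule sum.cong) (auto simp: decrease_def)
  ultimately show ?thesis
    unfolding trigger_cost_def h_def[symmetric] by (simp add: decrease_def)
qed

lemma trigger_cost_nonneg: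
  assumes "\<And>j. b j > 0" and "A > 0"
  shows "trigger_cost lam b A \<tau> i \<ge> 0"
  unfolding trigger_cost_def
  by (intro add_nonneg_nonneg sum_nonneg mult_nonneg_nonneg infsum_nonneg)
    (use assms in \<open>auto intro: less_imp_le\<close>)

lemma g_hat_nonneg:
  assumes "\<And>j. lam j > 0" and "\<And>j. b j > 0"
  shows "g_hat lam b \<tau> i \<ge> 0"
  unfolding g_hat_def using assms by (intro sum_nonneg mult_nonneg_nonneg) (auto intro: less_imp_le)

text \<open>A lower stock level enlarges the tail event of each item.\<close>

lemma g_hat_antimono:
  assumes "\<And>j. lam j > 0" and "\<And>j. b j > 0" and "i \<le> i'"
  shows "g_hat lam b \<tau> i' \<le> g_hat lam b \<tau> i"
  unfolding g_hat_def
  by (intro sum_mono mult_left_mono measure_pmf.finite_measure_mono mult_nonneg_nonneg)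
    (use assms in \<open>auto simp: le_fun_def intro: less_imp_le order_trans\<close>)

lemma g_hat_le:
  assumes "\<And>j. lam j > 0" and "\<And>j. b j > 0"
  shows "g_hat lam b \<tau> i \<le> (\<Sum>j\<in>UNIV. lam j * b j)"
  unfolding g_hat_def
  by (intro sum_mono mult_left_le) (use assms in \<open>auto intro: less_imp_le\<close>)

lemma total_rate_pos:
  assumes "\<And>j. lam j > 0"
  shows "total_rate lam > 0"
  unfolding total_rate_def by (rule sum_pos) (auto simp: assms)

section \<open>The stopped chain and the hitting time\<close>

lemma decrease_le: "decrease j i \<le> i"
  by (auto simp: le_fun_def decrease_def)

lemma chain_antimono: "m \<le> n \<Longrightarrow> chain i w n \<le> chain i w m"
proof (induction n)
  case (Suc n)
  then show ?case
    by (cases "m = Suc n") (auto intro: order_trans[OF decrease_le])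
qed simp

lemma chain_in_state_space: "chain Q w n \<in> state_space Q"
  using chain_antimono[of 0 n Q w] by (auto simp: state_space_def le_fun_def)

text \<open>The chain frozen at its first entry into \<open>U\<close>. Its value at step
  \<open>n\<close> depends on the first \<open>n\<close> demands only and is defined on all paths,
  including those that never enter \<open>U\<close>.\<close>

primrec stopped_chain :: "'j state \<Rightarrow> 'j state set \<Rightarrow> (nat \<Rightarrow> 'j) \<Rightarrow> nat \<Rightarrow> 'j state" where
  "stopped_chain i U w 0 = i"
| "stopped_chain i U w (Suc n) = (if stopped_chain i U w n \<in> U then stopped_chain i U w n
     else decrease (w n) (stopped_chain i U w n))"

text \<open>The sequence \<open>case_nat j w\<close> puts the demand \<open>j\<close> in front of
  \<open>w\<close>, so this is the first-step decomposition of a path.\<close>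

lemma stopped_chain_case_nat:
  "stopped_chain i U (case_nat j w) (Suc n) =
    (if i \<in> U then i else stopped_chain (decrease j i) U w n)"
  by (induction n) auto

lemma stopped_chain_notin_iff:
  "stopped_chain i U w n \<notin> U \<longleftrightarrow> (\<forall>m\<le>n. chain i w m \<notin> U)"
  "stopped_chain i U w n \<notin> U \<Longrightarrow> stopped_chain i U w n = chain i w n"
proof -
  \<comment> \<open>Both claims go through one induction: whether step \<open>Suc n\<close> enters
    \<open>U\<close> can be read off the free chain only if the two chains agree at
    \<open>n\<close>.\<close>
  have "(stopped_chain i U w n \<notin> U \<longleftrightarrow> (\<forall>m\<le>n. chain i w m \<notin> U)) \<and>
      (stopped_chain i U w n \<notin> U \<longrightarrow> stopped_chain i U w n = chain i w n)"
  proof (induction n)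
    case (Suc n)
    have "(\<forall>m\<le>Suc n. chain i w m \<notin> U) \<longleftrightarrow> (\<forall>m\<le>n. chain i w m \<notin> U) \<and> chain i w (Suc n) \<notin> U"
      by (blast elim: le_SucE intro: le_SucI)
    then show ?case
      using Suc by (cases "stopped_chain i U w n \<in> U") simp_all
  qed simp
  then show "stopped_chain i U w n \<notin> U \<longleftrightarrow> (\<forall>m\<le>n. chain i w m \<notin> U)"
    "stopped_chain i U w n \<notin> U \<Longrightarrow> stopped_chain i U w n = chain i w n" by auto
qed

lemma stopped_chain_freeze:
  assumes "stopped_chain i U w m \<in> U" and "m \<le> n"
  shows "stopped_chain i U w n = stopped_chain i U w m"
  using assms(2,1) by (induction rule: dec_induct) auto

lemma hit_time_eq:
  "hit_time i U w = (if \<exists>n. chain i w n \<in> U then enat (LEAST n. chain i w n \<in> U) else \<infinity>)"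
proof (cases "\<exists>n. chain i w n \<in> U")
  case True
  have "hit_time i U w = enat (LEAST n. chain i w n \<in> U)"
    unfolding hit_time_def
    by (intro antisym INF_lower INF_greatest)
      (use True in \<open>auto intro: LeastI_ex Least_le\<close>)
  then show ?thesis using True by simp
qed (simp add: hit_time_def top_enat_def)

lemma stopped_chain_notin_iff_less_hit_time:
  "stopped_chain i U w n \<notin> U \<longleftrightarrow> enat n < hit_time i U w"
proof -
  have "(\<forall>m\<le>n. chain i w m \<notin> U) \<longleftrightarrow> enat n < hit_time i U w"
    unfolding hit_time_eq
    by (auto simp: not_le[symmetric] intro: Least_le order_trans)
      (metis LeastI_ex)
  then show ?thesis by (simp add: stopped_chain_notin_iff)
qed

lemma stopped_chain_at_hit_time:
  assumes "hit_time i U w = enat N"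
  shows "chain i w N \<in> U" and "stopped_chain i U w N = chain i w N"
proof -
  show "chain i w N \<in> U"
    using assms unfolding hit_time_eq by (auto split: if_splits intro: LeastI)
  show "stopped_chain i U w N = chain i w N"
  proof (cases N)
    \<comment> \<open>One step before the entry the two chains still agree outside \<open>U\<close>,
      so they make the same last move.\<close>
    case (Suc n)
    then have "stopped_chain i U w n \<notin> U"
      using assms by (simp add: stopped_chain_notin_iff_less_hit_time)
    then show ?thesis using Suc stopped_chain_notin_iff(2)[of i U w n] by simp
  qed simp
qed

text \<open>The number \<open>N\<close> counts the indices below it. Integrated, this gives the
  tail-sum formula for the expected hitting time.\<close>

lemma ennreal_of_enat_eq_suminf:
  "ennreal_of_enat N = (\<Sum>n. of_bool (enat n < N))"
proof (cases N)
  case (enat m)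
  have "(\<Sum>n. of_bool (enat n < N) :: ennreal) = (\<Sum>n<m. of_bool (enat n < N))"
    by (rule suminf_finite) (auto simp: enat)
  then show ?thesis by (simp add: enat)
next
  case infinity
  have "(\<Sum>n. 1 :: ennreal) = top"
    using suminf_eq_SUP[of "\<lambda>_. 1 :: ennreal"] by (simp add: ennreal_SUP_of_nat_eq_top)
  then show ?thesis by (simp add: infinity)
qed

section \<open>Measurability and conditioning on the first demand\<close>

lemma sequence_space_measure_pmf: "sequence_space (measure_pmf p)"
  by unfold_locales

lemma measurable_stopped_chain [measurable]:
  fixes lam :: "'j::finite \<Rightarrow> real"
  shows "(\<lambda>w. stopped_chain i U w n) \<in> demand_space lam \<rightarrow>\<^sub>M count_space UNIV"
proof (induction n)
  case (Suc n)
  note Suc[measurable]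
  have [measurable]: "(\<lambda>w. w n) \<in> demand_space lam \<rightarrow>\<^sub>M count_space UNIV"
    unfolding demand_space_def by measurable
  \<comment> \<open>As \<open>'j\<close> is finite, there are only countably many pairs of state and
    demand, so discrete sigma-algebras suffice.\<close>
  have "(\<lambda>w. (\<lambda>(s, j). if s \<in> U then s else decrease j s) (stopped_chain i U w n, w n))
      \<in> demand_space lam \<rightarrow>\<^sub>M count_space UNIV"
    by (rule measurable_compose[where N="count_space UNIV"]) measurable
  then show ?case by simp
qed simp

lemma measurable_chain [measurable]:
  fixes lam :: "'j::finite \<Rightarrow> real"
  shows "(\<lambda>w. chain i w n) \<in> demand_space lam \<rightarrow>\<^sub>M count_space UNIV"
proof -
  have "stopped_chain i {} w n = chain i w n" for w
    by (rule stopped_chain_notin_iff(2)) simp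
  then show ?thesis using measurable_stopped_chain[of i "{}" n lam] by simp
qed

text \<open>The transition operator of the chain made absorbing on \<open>U\<close>, acting on
  functions of the state.\<close>

definition step_operator ::
    "('j::finite \<Rightarrow> real) \<Rightarrow> 'j state set \<Rightarrow> ('j state \<Rightarrow> ennreal) \<Rightarrow> 'j state \<Rightarrow> ennreal" where
  "step_operator lam U F i = (if i \<in> U then F i
     else (\<Sum>j\<in>UNIV. ennreal (lam j / total_rate lam) * F (decrease j i)))"

text \<open>The first demand is independent of the later ones, and the shifted sequence has the same
  law as the whole one (\<open>PiM_iter\<close>).\<close>

lemma nn_integral_demand_space_case_nat:
  fixes lam :: "'j::finite \<Rightarrow> real"
  assumes pos: "\<And>j. lam j > 0" and f: "f \<in> borel_measurable (demand_space lam)"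
  shows "(\<integral>\<^sup>+w. f w \<partial>demand_space lam) =
    (\<Sum>j\<in>UNIV. ennreal (lam j / total_rate lam) * (\<integral>\<^sup>+w. f (case_nat j w) \<partial>demand_space lam))"
proof -
  let ?M = "measure_pmf (item_pmf lam)"
  interpret sequence_space ?M by (rule sequence_space_measure_pmf)
  have [measurable]: "f \<in> borel_measurable S" using f by (simp add: demand_space_def)
  have "(\<integral>\<^sup>+w. f w \<partial>S) = (\<integral>\<^sup>+w. f w \<partial>distr (?M \<Otimes>\<^sub>M S) S (\<lambda>(s, \<omega>). case_nat s \<omega>))"
    by (simp add: PiM_iter)
  also have "\<dots> = (\<integral>\<^sup>+x. f (case x of (s, \<omega>) \<Rightarrow> case_nat s \<omega>) \<partial>(?M \<Otimes>\<^sub>M S))"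
    by (rule nn_integral_distr) measurable
  also have "\<dots> = (\<integral>\<^sup>+j. \<integral>\<^sup>+w. f (case_nat j w) \<partial>S \<partial>?M)"
    by (subst nn_integral_fst[symmetric]) simp_all
  also have "\<dots> = (\<Sum>j\<in>UNIV. (\<integral>\<^sup>+w. f (case_nat j w) \<partial>S) * ennreal (pmf (item_pmf lam) j))"
    by (rule nn_integral_measure_pmf_support) auto
  finally show ?thesis
    by (simp add: demand_space_def pmf_item_pmf[of lam, OF pos] mult.commute)
qed

lemma emeasure_demand_space: "emeasure (demand_space lam) (space (demand_space lam)) = 1"
proof -
  interpret sequence_space "measure_pmf (item_pmf lam)" by (rule sequence_space_measure_pmf)
  show ?thesis unfolding demand_space_def by (rule P.emeasure_space_1)
qed

text \<open>After a first demand \<open>j\<close> outside \<open>U\<close> the process restarts from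
  \<open>decrease j i\<close>; hence the induction on \<open>n\<close> with an arbitrary initial
  state.\<close>

lemma nn_integral_stopped_chain:
  fixes lam :: "'j::finite \<Rightarrow> real"
  assumes pos: "\<And>j. lam j > 0"
  shows "(\<integral>\<^sup>+w. F (stopped_chain i U w n) \<partial>demand_space lam) = (step_operator lam U ^^ n) F i"
proof (induction n arbitrary: i)
  case 0
  then show ?case by (simp add: emeasure_demand_space)
next
  case (Suc n)
  have p: "(\<Sum>j\<in>UNIV. ennreal (lam j / total_rate lam)) = 1"
    using pmf_item_pmf[of lam, OF pos] sum_pmf_eq_1[of UNIV "item_pmf lam"]
    by (simp flip: pmf_item_pmf[of lam, OF pos])
  \<comment> \<open>For a start in \<open>U\<close> every summand has the same integral
    \<open>F i\<close>, and the weights add up to one.\<close>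
  have frozen: "(step_operator lam U ^^ n) F i = F i" if "i \<in> U"
    using that by (induction n) (auto simp: step_operator_def)
  have "(\<integral>\<^sup>+w. F (stopped_chain i U w (Suc n)) \<partial>demand_space lam) =
      (\<Sum>j\<in>UNIV. ennreal (lam j / total_rate lam) *
        (\<integral>\<^sup>+w. F (stopped_chain i U (case_nat j w) (Suc n)) \<partial>demand_space lam))"
    by (rule nn_integral_demand_space_case_nat[OF pos]) measurable
  also have "\<dots> = step_operator lam U ((step_operator lam U ^^ n) F) i"
    unfolding step_operator_def[of lam U "(step_operator lam U ^^ n) F"]
    by (auto simp: stopped_chain_case_nat Suc.IH emeasure_demand_space frozen p
        simp flip: sum_distrib_right simp del: stopped_chain.simps)
  finally show ?case by simp
qed

text \<open>Powers of an operator commute with it, so conditioning on the first demand turns into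
  conditioning on the last one.\<close>

lemma nn_integral_stopped_chain_Suc:
  fixes lam :: "'j::finite \<Rightarrow> real"
  assumes pos: "\<And>j. lam j > 0"
  shows "(\<integral>\<^sup>+w. F (stopped_chain i U w (Suc n)) \<partial>demand_space lam) =
    (\<integral>\<^sup>+w. step_operator lam U F (stopped_chain i U w n) \<partial>demand_space lam)"
  unfolding nn_integral_stopped_chain[of lam F, OF pos]
    nn_integral_stopped_chain[of lam "step_operator lam U F", OF pos]
  by (simp only: funpow_Suc_right o_apply)

section \<open>Expected hitting times and optional stopping\<close>

lemma expected_steps_eq_suminf:
  "expected_steps i lam U =
    (\<Sum>n. \<integral>\<^sup>+w. of_bool (stopped_chain i U w n \<notin> U) \<partial>demand_space lam)"
  unfolding expected_steps_def ennreal_of_enat_eq_suminf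
    stopped_chain_notin_iff_less_hit_time[symmetric]
  by (rule nn_integral_suminf) measurable

text \<open>Foster-Lyapunov criterion: each step made outside \<open>U\<close> uses up at least one
  unit of the mean of \<open>W\<close>, so the expected number of such steps is at most
  \<open>W i\<close>.\<close>

lemma expected_steps_finite_of_drift:
  assumes pos: "\<And>j. lam j > 0"
    and drift: "\<And>s. s \<in> state_space i \<Longrightarrow> s \<notin> U \<Longrightarrow>
      (\<Sum>j\<in>UNIV. ennreal (lam j / total_rate lam) * W (decrease j s)) + 1 \<le> W s"
    and fin: "W i < \<infinity>"
  shows "expected_steps i lam U < \<infinity>"
proof -
  let ?E = "\<lambda>f. \<integral>\<^sup>+w. f w \<partial>demand_space lam"
  have "(\<Sum>k<n. ?E (\<lambda>w. of_bool (stopped_chain i U w k \<notin> U)))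
      + ?E (\<lambda>w. W (stopped_chain i U w n)) \<le> W i" for n
  proof (induction n)
    case 0
    show ?case by (simp add: emeasure_demand_space)
  next
    case (Suc n)
    \<comment> \<open>Inside \<open>U\<close> both sides equal \<open>W\<close>. Outside, the
      stopped chain is the free chain, hence lies in the state space, where \<open>drift\<close>
      applies.\<close>
    have "step_operator lam U W (stopped_chain i U w n) + of_bool (stopped_chain i U w n \<notin> U)
        \<le> W (stopped_chain i U w n)" for w
      using drift[of "stopped_chain i U w n"] chain_in_state_space[of i w n]
        stopped_chain_notin_iff(2)[of i U w n]
      by (auto simp: step_operator_def)
    then have "?E (\<lambda>w. of_bool (stopped_chain i U w n \<notin> U) + step_operator lam U W (stopped_chain i U w n))
        \<le> ?E (\<lambda>w. W (stopped_chain i U w n))"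
      by (intro nn_integral_mono) (simp add: add.commute)
    then have "?E (\<lambda>w. of_bool (stopped_chain i U w n \<notin> U)) + ?E (\<lambda>w. W (stopped_chain i U w (Suc n)))
        \<le> ?E (\<lambda>w. W (stopped_chain i U w n))"
      unfolding nn_integral_stopped_chain_Suc[of lam W, OF pos]
    by (subst (asm) nn_integral_add) simp_all
    then show ?case
      using Suc by (auto simp: add.assoc simp del: stopped_chain.simps intro: order_trans add_left_mono)
  qed
  then have "(\<Sum>k<n. ?E (\<lambda>w. of_bool (stopped_chain i U w k \<notin> U))) \<le> W i" for n
    by (meson add_increasing2 order_trans le_iff_add)
  then have "expected_steps i lam U \<le> W i"
    unfolding expected_steps_eq_suminf suminf_eq_SUP by (intro SUP_least)
  then show ?thesis using fin by (rule le_less_trans)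
qed

text \<open>On paths that never enter \<open>U\<close>, \<open>the_enat\<close> gives a fixed
  unspecified number, so the function is constant there.\<close>

lemma measurable_the_enat_hit_time [measurable]:
  fixes lam :: "'j::finite \<Rightarrow> real"
  shows "(\<lambda>w. the_enat (hit_time i U w)) \<in> demand_space lam \<rightarrow>\<^sub>M count_space UNIV"
  unfolding hit_time_eq if_distrib[of the_enat] the_enat.simps by measurable

lemma measurable_chain_at_hit_time [measurable]:
  fixes lam :: "'j::finite \<Rightarrow> real"
  shows "(\<lambda>w. chain i w (the_enat (hit_time i U w))) \<in> demand_space lam \<rightarrow>\<^sub>M count_space UNIV"
  by (rule measurable_compose_countable) measurable

lemma hit_time_AE_finite:
  assumes "expected_steps i lam U < \<infinity>"
  shows "AE w in demand_space lam. hit_time i U w \<noteq> \<infinity>"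
proof -
  have "AE w in demand_space lam. ennreal_of_enat (hit_time i U w) \<noteq> \<infinity>"
  proof (rule nn_integral_PInf_AE)
    show "(\<lambda>w. ennreal_of_enat (hit_time i U w)) \<in> borel_measurable (demand_space lam)"
      unfolding ennreal_of_enat_eq_suminf stopped_chain_notin_iff_less_hit_time[symmetric]
      by measurable
    show "(\<integral>\<^sup>+w. ennreal_of_enat (hit_time i U w) \<partial>demand_space lam) \<noteq> \<infinity>"
      using assms by (simp add: expected_steps_def)
  qed
  then show ?thesis by eventually_elim (metis ennreal_of_enat_infty)
qed

text \<open>Dynkin's formula: the mean increments \<open>c\<close> are summed up to a fixed step
  \<open>n\<close>. Since \<open>F\<close> never decreases along the chain, monotone convergence
  then carries the identity to the hitting time.\<close>

lemma nn_integral_chain_at_hit_time: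
  assumes pos: "\<And>j. lam j > 0"
    and drift: "\<And>s. (\<Sum>j\<in>UNIV. ennreal (lam j / total_rate lam) * F (decrease j s)) = F s + c s"
    and mono: "\<And>j s. F s \<le> F (decrease j s)"
    and fin: "expected_steps i lam U < \<infinity>"
  shows "(\<integral>\<^sup>+w. F (chain i w (the_enat (hit_time i U w))) \<partial>demand_space lam) =
    F i + (\<Sum>n. \<integral>\<^sup>+w. of_bool (stopped_chain i U w n \<notin> U) * c (stopped_chain i U w n) \<partial>demand_space lam)"
proof -
  let ?E = "\<lambda>f. \<integral>\<^sup>+w. f w \<partial>demand_space lam"
  define S where "S = stopped_chain i U"
  have partial: "?E (\<lambda>w. F (S w n)) = F i + (\<Sum>k<n. ?E (\<lambda>w. of_bool (S w k \<notin> U) * c (S w k)))" for n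
  proof (induction n)
    case 0
    show ?case by (simp add: S_def emeasure_demand_space)
  next
    case (Suc n)
    have "?E (\<lambda>w. F (S w (Suc n))) = ?E (\<lambda>w. step_operator lam U F (S w n))"
      unfolding S_def by (rule nn_integral_stopped_chain_Suc[OF pos])
    also have "\<dots> = ?E (\<lambda>w. F (S w n) + of_bool (S w n \<notin> U) * c (S w n))"
      by (intro nn_integral_cong) (simp add: step_operator_def drift)
    also have "\<dots> = ?E (\<lambda>w. F (S w n)) + ?E (\<lambda>w. of_bool (S w n \<notin> U) * c (S w n))"
      unfolding S_def by (rule nn_integral_add) measurable
    finally show ?case using Suc by (simp add: add.assoc)
  qed
  have inc: "incseq (\<lambda>n. F (S w n))" for w
    by (rule incseq_SucI) (simp add: S_def mono)
  \<comment> \<open>Once in \<open>U\<close> the stopped chain is constant, so the supremum of the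
    increasing values is the one at the hitting time.\<close>
  have "AE w in demand_space lam. F (chain i w (the_enat (hit_time i U w))) = (SUP n. F (S w n))"
    using hit_time_AE_finite[OF fin]
  proof eventually_elim
    case (elim w)
    then obtain N where N: "hit_time i U w = enat N" by auto
    have "F (S w n) \<le> F (S w N)" for n
    proof -
      have "F (S w n) \<le> F (S w (max n N))" by (rule incseqD[OF inc]) simp
      also have "S w (max n N) = S w N"
        unfolding S_def using stopped_chain_at_hit_time[OF N] by (intro stopped_chain_freeze) auto
      finally show ?thesis .
    qed
    then have "(SUP n. F (S w n)) = F (S w N)"
      by (intro antisym SUP_least SUP_upper) auto
    then show ?case using stopped_chain_at_hit_time[OF N] N by (simp add: S_def)
  qed
  then have "?E (\<lambda>w. F (chain i w (the_enat (hit_time i U w)))) = ?E (\<lambda>w. SUP n. F (S w n))"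
    by (rule nn_integral_cong_AE)
  also have "\<dots> = (SUP n. ?E (\<lambda>w. F (S w n)))"
    using inc by (intro nn_integral_monotone_convergence_SUP)
      (auto simp: incseq_def le_fun_def S_def)
  also have "\<dots> = F i + (SUP n. \<Sum>k<n. ?E (\<lambda>w. of_bool (S w k \<notin> U) * c (S w k)))"
    unfolding partial by (rule ennreal_SUP_add_right[symmetric]) auto
  finally show ?thesis by (simp add: suminf_eq_SUP S_def)
qed

section \<open>Average cost through expected increments\<close>

text \<open>By Dynkin's formula this is the excess of the expected stopping cost over the trigger
  cost at \<open>Q\<close>, when the expected hitting time is finite.\<close>

definition running_cost ::
    "'j state \<Rightarrow> ('j::finite \<Rightarrow> real) \<Rightarrow> ('j \<Rightarrow> real) \<Rightarrow> real \<Rightarrow> 'j state set \<Rightarrow> ennreal" where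
  "running_cost Q lam b \<tau> U =
     (\<Sum>n. \<integral>\<^sup>+w. of_bool (stopped_chain Q U w n \<notin> U)
        * ennreal (g_hat lam b \<tau> (stopped_chain Q U w n) / total_rate lam) \<partial>demand_space lam)"

text \<open>Each increment is bounded by the constant \<open>B\<close>, so the sum is at most
  \<open>B\<close> times the expected number of steps.\<close>

lemma running_cost_finite:
  assumes pos: "\<And>j. lam j > 0" "\<And>j. b j > 0"
    and fin: "expected_steps Q lam U < \<infinity>"
  shows "running_cost Q lam b \<tau> U < \<infinity>"
proof -
  define B where "B = (\<Sum>j\<in>UNIV. lam j * b j) / total_rate lam"
  have "running_cost Q lam b \<tau> U \<le>
      (\<Sum>n. \<integral>\<^sup>+w. ennreal B * of_bool (stopped_chain Q U w n \<notin> U) \<partial>demand_space lam)"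
    unfolding running_cost_def
    by (intro suminf_le nn_integral_mono)
      (auto simp: B_def intro!: ennreal_leI divide_right_mono g_hat_le[of lam b, OF pos]
        less_imp_le[OF total_rate_pos[OF pos(1)]])
  also have "\<dots> = ennreal B * expected_steps Q lam U"
    by (simp add: expected_steps_eq_suminf nn_integral_cmult)
  also have "\<dots> < \<infinity>" using fin by (simp add: ennreal_mult_less_top)
  finally show ?thesis .
qed

text \<open>Dynkin's formula with the trigger cost as \<open>F\<close>; averaging the increments of
  \<open>trigger_cost_decrease\<close> over the demanded item gives
  \<open>g_hat / total_rate\<close> as \<open>c\<close>.\<close>

lemma avg_cost_eq:
  assumes pos: "\<And>j. lam j > 0" "\<And>j. b j > 0" "A > 0" "\<tau> > 0"
    and fin: "expected_steps Q lam U < \<infinity>"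
  shows "avg_cost Q lam b A \<tau> U =
    (trigger_cost lam b A \<tau> Q + enn2real (running_cost Q lam b \<tau> U))
      / (\<tau> + enn2real (expected_steps Q lam U) / total_rate lam)"
proof -
  let ?G = "trigger_cost lam b A \<tau>"
  note L = total_rate_pos[of lam, OF pos(1)]
  note G = trigger_cost_nonneg[of b A lam \<tau>, OF pos(2,3)]
  have step: "?G s \<le> ?G (decrease j s)" for j s
    by (simp add: trigger_cost_decrease[of lam, OF pos(1,4)] less_imp_le[OF pos(2)])
  have drift: "(\<Sum>j\<in>UNIV. ennreal (lam j / total_rate lam) * ennreal (?G (decrease j s)))
      = ennreal (?G s) + ennreal (g_hat lam b \<tau> s / total_rate lam)" for s
  proof -
    have "(\<Sum>j\<in>UNIV. ennreal (lam j / total_rate lam) * ennreal (?G (decrease j s)))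
        = ennreal (\<Sum>j\<in>UNIV. lam j / total_rate lam * ?G (decrease j s))"
      using L pos(1) G by (simp add: ennreal_mult'[symmetric] less_imp_le)
    also have "(\<Sum>j\<in>UNIV. lam j / total_rate lam * ?G (decrease j s))
        = (\<Sum>j\<in>UNIV. lam j * ?G s + lam j * b j * measure_pmf.prob (lead_demand (lam j) \<tau>) {s j..})
            / total_rate lam"
      by (simp add: trigger_cost_decrease[of lam, OF pos(1,4)] sum_divide_distrib
          distrib_left add_divide_distrib mult.assoc)
    also have "\<dots> = ?G s + g_hat lam b \<tau> s / total_rate lam"
      using L by (simp add: g_hat_def sum.distrib add_divide_distrib
          flip: sum_distrib_right total_rate_def)
    finally show ?thesis
      using G g_hat_nonneg[of lam b, OF pos(1,2)] L by simp
  qed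
  \<comment> \<open>For a nonnegative measurable function the two integrals agree under
    \<open>enn2real\<close>; finiteness enters when \<open>enn2real\<close> is split over the
    sum.\<close>
  have "(\<integral>w. ?G (chain Q w (the_enat (hit_time Q U w))) \<partial>demand_space lam)
      = enn2real (\<integral>\<^sup>+w. ennreal (?G (chain Q w (the_enat (hit_time Q U w)))) \<partial>demand_space lam)"
    by (rule integral_eq_nn_integral) (auto simp: G)
  also have "\<dots> = enn2real (ennreal (?G Q) + running_cost Q lam b \<tau> U)"
    unfolding running_cost_def
    by (subst nn_integral_chain_at_hit_time[where F="\<lambda>s. ennreal (?G s)", OF pos(1) drift _ fin])
      (auto intro: ennreal_leI step)
  also have "\<dots> = ?G Q + enn2real (running_cost Q lam b \<tau> U)"
    using running_cost_finite[of lam b, OF pos(1,2) fin, of \<tau>] G by (subst enn2real_plus) auto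
  finally show ?thesis by (simp add: avg_cost_def)
qed

text \<open>
  The threshold rule minimises \<open>running_cost - (\<alpha> / total_rate) * expected_steps\<close>; both sides are
  rearranged so that no subtraction in \<open>ennreal\<close> occurs.
\<close>

lemma running_cost_threshold:
  fixes Q :: "'j::finite state" and lam b :: "'j \<Rightarrow> real" and \<tau> \<alpha> :: real
  assumes pos: "\<And>j. lam j > 0" "\<And>j. b j > 0" and \<alpha>: "\<alpha> \<ge> 0"
  defines "T \<equiv> {s \<in> state_space Q. \<alpha> < g_hat lam b \<tau> s}"
  shows "running_cost Q lam b \<tau> T + ennreal (\<alpha> / total_rate lam) * expected_steps Q lam U
    \<le> running_cost Q lam b \<tau> U + ennreal (\<alpha> / total_rate lam) * expected_steps Q lam T"
proof -
  let ?E = "\<lambda>f. \<integral>\<^sup>+w. f w \<partial>demand_space lam"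
  define a where "a = ennreal (\<alpha> / total_rate lam)"
  define g where "g s = ennreal (g_hat lam b \<tau> s / total_rate lam)" for s
  define v :: "'j state set \<Rightarrow> (nat \<Rightarrow> 'j) \<Rightarrow> nat \<Rightarrow> ennreal"
    where "v V w n = of_bool (stopped_chain Q V w n \<notin> V)" for V w n
  have split: "running_cost Q lam b \<tau> V + a * expected_steps Q lam V' =
      (\<Sum>n. ?E (\<lambda>w. v V w n * g (stopped_chain Q V w n) + a * v V' w n))" for V V'
    unfolding running_cost_def expected_steps_eq_suminf v_def g_def
    by (subst nn_integral_add, measurable, subst nn_integral_cmult, measurable)
      (simp add: suminf_add[symmetric])
  \<comment> \<open>The comparison holds for every path and step. In real terms it says
    \<open>(v T - v U) * (g - a) \<le> 0\<close>, where \<open>v T\<close> is 1 exactly when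
    \<open>g_hat\<close> is still at most \<open>\<alpha>\<close>.\<close>
  have "v T w n * g (stopped_chain Q T w n) + a * v U w n
      \<le> v U w n * g (stopped_chain Q U w n) + a * v T w n" for w n
  proof -
    have mono: "g_hat lam b \<tau> (chain Q w m) \<le> g_hat lam b \<tau> (chain Q w n)" if "m \<le> n" for m
      by (intro g_hat_antimono[of lam b, OF pos] chain_antimono that)
    \<comment> \<open>As \<open>g_hat\<close> never decreases along the chain, being below the
      threshold at \<open>n\<close> implies it at all earlier steps.\<close>
    have alive: "stopped_chain Q T w n \<notin> T \<longleftrightarrow> g_hat lam b \<tau> (chain Q w n) \<le> \<alpha>"
      unfolding stopped_chain_notin_iff(1) T_def
    proof (intro iffI allI impI)
      assume "\<forall>m\<le>n. chain Q w m \<notin> {s \<in> state_space Q. \<alpha> < g_hat lam b \<tau> s}"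
      then show "g_hat lam b \<tau> (chain Q w n) \<le> \<alpha>" by (simp add: chain_in_state_space not_less)
    next
      fix m assume "g_hat lam b \<tau> (chain Q w n) \<le> \<alpha>" "m \<le> n"
      then show "chain Q w m \<notin> {s \<in> state_space Q. \<alpha> < g_hat lam b \<tau> s}"
        using mono[of m] by simp
    qed
    show ?thesis
    proof (cases "stopped_chain Q T w n \<in> T")
      case True
      then have "a \<le> g (chain Q w n)"
        unfolding a_def g_def using alive less_imp_le[OF total_rate_pos[of lam, OF pos(1)]]
        by (intro ennreal_leI divide_right_mono) auto
      then show ?thesis
        using True stopped_chain_notin_iff(2)[of Q U w n] by (auto simp: v_def)
    next
      case False
      then have "g (chain Q w n) \<le> a"
        unfolding a_def g_def using alive less_imp_le[OF total_rate_pos[of lam, OF pos(1)]]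
        by (intro ennreal_leI divide_right_mono) auto
      then show ?thesis
        using False stopped_chain_notin_iff(2)[of Q T w n] stopped_chain_notin_iff(2)[of Q U w n]
        by (auto simp: v_def add.commute)
    qed
  qed
  then show ?thesis
    unfolding a_def[symmetric] split
    by (intro suminf_le nn_integral_mono) auto
qed

section \<open>Admissibility and optimality of the threshold set\<close>

text \<open>While the chain is outside \<open>U\<close>, some item is still above its level in
  \<open>k\<close>. A weighted count of the units above \<open>k\<close> therefore satisfies the
  drift criterion.\<close>

lemma expected_steps_finite_of_downset:
  fixes lam :: "'j::finite \<Rightarrow> real"
  assumes pos: "\<And>j. lam j > 0" and down: "\<And>s. s \<in> state_space i \<Longrightarrow> s \<le> k \<Longrightarrow> s \<in> U"
  shows "expected_steps i lam U < \<infinity>"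
proof -
  note L = total_rate_pos[of lam, OF pos]
  define p where "p j = lam j / total_rate lam" for j
  have p: "p j > 0" for j using L pos by (simp add: p_def)
  have p1: "(\<Sum>j\<in>UNIV. p j) = 1"
    using L by (simp add: p_def total_rate_def flip: sum_divide_distrib)
  \<comment> \<open>Item \<open>j\<close> is demanded once in \<open>1 / p j\<close> steps on average, so \<open>W\<close> falls by at least 1 per step in mean.\<close>
  define W where "W s = (\<Sum>j\<in>UNIV. real_of_int (max 0 (s j - k j)) / p j)" for s :: "'j state"
  have W0: "W s \<ge> 0" for s
    unfolding W_def using p by (intro sum_nonneg divide_nonneg_pos) auto
  have step: "W (decrease j s) = W s - of_bool (s j > k j) / p j" for j s
  proof -
    have "W x = real_of_int (max 0 (x j - k j)) / p j
        + (\<Sum>l\<in>UNIV - {j}. real_of_int (max 0 (x l - k l)) / p l)" for x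
      unfolding W_def by (rule sum.remove) auto
    moreover have "(\<Sum>l\<in>UNIV - {j}. real_of_int (max 0 (decrease j s l - k l)) / p l)
        = (\<Sum>l\<in>UNIV - {j}. real_of_int (max 0 (s l - k l)) / p l)"
      by (rule sum.cong) (auto simp: decrease_def)
    moreover have "real_of_int (max 0 (decrease j s j - k j))
        = real_of_int (max 0 (s j - k j)) - of_bool (s j > k j)"
      by (auto simp: decrease_def)
    ultimately show ?thesis by (simp add: diff_divide_distrib)
  qed
  show ?thesis
  proof (rule expected_steps_finite_of_drift[where W="\<lambda>s. ennreal (W s)", OF pos])
    fix s assume "s \<in> state_space i" "s \<notin> U"
    then obtain l where l: "s l > k l" using down[of s] by (meson le_funI not_le)
    \<comment> \<open>The weight \<open>1 / p j\<close> cancels the probability \<open>p j\<close>: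
      each item still above its level contributes exactly one to the mean decrease.\<close>
    have "(\<Sum>j\<in>UNIV. p j * W (decrease j s)) = (\<Sum>j\<in>UNIV. p j * W s - of_bool (s j > k j))"
      using p by (intro sum.cong) (auto simp: step right_diff_distrib less_imp_neq[THEN not_sym])
    also have "\<dots> = W s - (\<Sum>j\<in>UNIV. of_bool (s j > k j))"
      by (simp add: sum_subtractf p1 flip: sum_distrib_right)
    finally have "(\<Sum>j\<in>UNIV. p j * W (decrease j s)) + 1 \<le> W s"
      using member_le_sum[of l UNIV "\<lambda>j. of_bool (s j > k j) :: real"] l by simp
    then have "ennreal ((\<Sum>j\<in>UNIV. p j * W (decrease j s)) + 1) \<le> ennreal (W s)"
      by (rule ennreal_leI)
    then show "(\<Sum>j\<in>UNIV. ennreal (lam j / total_rate lam) * ennreal (W (decrease j s))) + 1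
        \<le> ennreal (W s)"
      using p W0 unfolding p_def[symmetric]
      by (simp add: ennreal_mult'[symmetric] less_imp_le sum_nonneg ennreal_plus)
  qed simp
qed

theorem theorem2:
  fixes Q :: "'j::finite \<Rightarrow> int" and lam b :: "'j \<Rightarrow> real" and A \<tau> :: real
  assumes "\<And>j. Q j \<ge> 1" and "\<And>j. lam j > 0" and "\<And>j. b j > 0"
    and "A > 0" and "\<tau> > 0"
    and min_attained: "\<exists>U. is_arg_min (avg_cost Q lam b A \<tau>) (admissible Q lam) U"
    and "g_hat lam b \<tau> Q \<le> opt_cost Q lam b A \<tau>"
    and "\<exists>i\<in>state_space Q. g_hat lam b \<tau> i > opt_cost Q lam b A \<tau>"
  shows "optimal_policy Q lam b A \<tau> (threshold_policy lam b \<tau> (opt_cost Q lam b A \<tau>))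
    \<and> policy_cost Q lam b A \<tau> (threshold_policy lam b \<tau> (opt_cost Q lam b A \<tau>))
        = opt_cost Q lam b A \<tau>"
proof -
  note pos = assms(2-5)
  note L = total_rate_pos[of lam, OF pos(1)]
  define \<alpha> where "\<alpha> = opt_cost Q lam b A \<tau>"
  define e where "e V = enn2real (expected_steps Q lam V)" for V
  define c where "c V = enn2real (running_cost Q lam b \<tau> V)" for V
  define d where "d V = \<tau> + e V / total_rate lam" for V
  have d: "d V > 0" for V
    using L pos(4) by (auto simp: d_def e_def intro!: add_pos_nonneg)
  obtain U where U: "admissible Q lam U"
    and Umin: "\<And>V. admissible Q lam V \<Longrightarrow> avg_cost Q lam b A \<tau> U \<le> avg_cost Q lam b A \<tau> V"
    using min_attained by (auto simp: is_arg_min_def not_less)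
  \<comment> \<open>Attainment turns the real infimum in \<open>opt_cost\<close> into the value at
    the minimiser \<open>U\<close>.\<close>
  have \<alpha>_eq: "\<alpha> = avg_cost Q lam b A \<tau> U"
    unfolding \<alpha>_def opt_cost_def by (rule cInf_eq_minimum) (use U Umin in auto)
  have \<alpha>0: "\<alpha> \<ge> 0"
    using assms(7) g_hat_nonneg[of lam b, OF pos(1,2)] order_trans unfolding \<alpha>_def by blast
  define T where "T = {s \<in> state_space Q. \<alpha> < g_hat lam b \<tau> s}"
  have T: "trigger_set Q (threshold_policy lam b \<tau> \<alpha>) = T"
    by (auto simp: trigger_set_def threshold_policy_def T_def)
  obtain k where "\<alpha> < g_hat lam b \<tau> k" using assms(8) by (auto simp: \<alpha>_def)
  \<comment> \<open>Every state of the state space below \<open>k\<close> has \<open>g_hat\<close>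
    at least as large as \<open>k\<close>, hence lies in \<open>T\<close>.\<close>
  then have finT: "expected_steps Q lam T < \<infinity>"
    by (intro expected_steps_finite_of_downset[where k=k, OF pos(1)])
      (auto simp: T_def intro: less_le_trans g_hat_antimono[of lam b, OF pos(1,2)])
  then have admT: "admissible Q lam T"
    using assms(7) by (auto simp: admissible_def T_def \<alpha>_def)
  have finU: "expected_steps Q lam U < \<infinity>" using U by (simp add: admissible_def)
  note avg = avg_cost_eq[of lam b A \<tau> Q, OF pos, folded c_def e_def, folded d_def]
  have "running_cost Q lam b \<tau> T + ennreal (\<alpha> / total_rate lam) * expected_steps Q lam U
      \<le> running_cost Q lam b \<tau> U + ennreal (\<alpha> / total_rate lam) * expected_steps Q lam T"
    unfolding T_def by (rule running_cost_threshold[of lam b, OF pos(1,2) \<alpha>0])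
  moreover have "running_cost Q lam b \<tau> V = ennreal (c V)" "expected_steps Q lam V = ennreal (e V)"
    if "V \<in> {T, U}" for V
    using that finT finU running_cost_finite[of lam b, OF pos(1,2), of Q V \<tau>]
    by (auto simp: c_def e_def)
  moreover have "ennreal (c V) + ennreal (\<alpha> / total_rate lam) * ennreal (e V')
      = ennreal (c V + \<alpha> / total_rate lam * e V')" for V V'
    using L \<alpha>0 by (subst ennreal_plus) (simp_all add: ennreal_mult'[symmetric] c_def e_def)
  ultimately have "ennreal (c T + \<alpha> / total_rate lam * e U) \<le> ennreal (c U + \<alpha> / total_rate lam * e T)"
    by simp
  then have "c T + \<alpha> / total_rate lam * e U \<le> c U + \<alpha> / total_rate lam * e T"
    using L \<alpha>0 by (subst (asm) ennreal_le_iff) (auto simp: c_def e_def)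
  moreover have "trigger_cost lam b A \<tau> Q + c U = \<alpha> * d U"
    using d[of U] by (simp add: \<alpha>_eq avg[OF finU])
  \<comment> \<open>At \<open>U\<close> the quantity
    \<open>trigger_cost Q + c - (\<alpha> / total_rate) * e\<close> equals
    \<open>\<alpha> * \<tau>\<close>, and at \<open>T\<close> it is no larger.\<close>
  ultimately have "trigger_cost lam b A \<tau> Q + c T \<le> \<alpha> * d T"
    by (simp add: d_def algebra_simps)
  then have "avg_cost Q lam b A \<tau> T \<le> \<alpha>"
    using d[of T] by (simp add: avg[OF finT] divide_le_eq)
  then have "avg_cost Q lam b A \<tau> T = \<alpha>"
    using Umin[OF admT] \<alpha>_eq by simp
  then show ?thesis
    unfolding optimal_policy_def policy_cost_def \<alpha>_def[symmetric] T using admT by simp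
qed

end
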